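(* Let $\operatorname{Poch}(z,a,q)=\sum_{k\ge0}(a;q)_k\frac{z^k}{k!}$, where $(a;q)_k=\prod_{j=0}^{k-1}(1-aq^j)$. Then the generating function \[ P(z,q)=\sum_{p}q^{\operatorname{queries}(p)}\frac{z^{|p|}}{|p|!} \] (sum over all set partitions $p$ of $\{1,\dots,n\}$, $n\ge0$, with $|p|=n$ and $\operatorname{queries}(p)$ the number of queries used by the universal AC algorithm to recover $p$) satisfies \[ P(z,q)=\operatorname{Poch}\!\left(-\frac{q}{1-q}z,\ \frac{1-q}{q},\ q\right)e^{\frac{q}{1-q}z}. \]
   Context: The universal AC algorithm recovers an unknown set partition of a finite labelled set by queries to an oracle answering whether two items are in the same block: if the set is empty it returns the empty partition; otherwise it takes the item $u$ of largest label, compares it with every other remaining item (one query each), forms the block of $u$ from the positively answered items, removes this block, recursively partitions the remaining items, and adds the block to the result. *)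

theory Defs
  imports "HOL-Computational_Algebra.Computational_Algebra" "HOL-Library.Disjoint_Sets"
begin

definition same_block :: "'a set set \<Rightarrow> 'a \<Rightarrow> 'a \<Rightarrow> bool" where
  "same_block p u v \<longleftrightarrow> (\<exists>B\<in>p. u \<in> B \<and> v \<in> B)"

(* universal_AC orc S runs the algorithm on the items S with oracle orc and returns the
   partition it finds together with the number of oracle queries it makes.  The label of an
   item is the item itself.  Only finite S are meaningful; infinite S is a dummy case. *)
function universal_AC :: "('a::linorder \<Rightarrow> 'a \<Rightarrow> bool) \<Rightarrow> 'a set \<Rightarrow> 'a set set \<times> nat" where
  "universal_AC orc S =
     (if S = {} \<or> infinite S then ({}, 0)
      else let u = Max S;
               others = S - {u};
               block = insert u {v \<in> others. orc u v};
               (p, k) = universal_AC orc (S - block)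
           in (insert block p, card others + k))"
  by auto

termination
proof (relation "measure (\<lambda>(orc, S). card S)")
  fix orc :: "'a \<Rightarrow> 'a \<Rightarrow> bool" and S :: "'a set" and u others block
  assume S: "\<not> (S = {} \<or> infinite S)"
    and u: "u = Max S" and block: "block = insert u {v \<in> others. orc u v}"
  have "u \<in> S"
    using S u by (simp add: Max_in)
  hence "S - block \<subset> S"
    using block by blast
  thus "((orc, S - block), (orc, S)) \<in> measure (\<lambda>(orc, S). card S)"
    using S by (simp add: psubset_card_mono)
qed simp

declare universal_AC.simps [simp del]

definition queries :: "'a::linorder set set \<Rightarrow> nat" where
  "queries p = snd (universal_AC (same_block p) (\<Union>p))"

lemma universal_AC_subpartition:
  assumes "disjoint p" "{} \<notin> p" "finite (\<Union>p)" "Q \<subseteq> p"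
  shows "fst (universal_AC (same_block p) (\<Union>Q)) = Q"
  using assms(4)
proof (induction "card (\<Union>Q)" arbitrary: Q rule: less_induct)
  case less
  have fin: "finite (\<Union>Q)"
    using assms(3) less.prems by (meson Union_mono finite_subset)
  show ?case
  proof (cases "\<Union>Q = {}")
    case True
    hence "Q = {}"
      using less.prems assms(2) by auto
    thus ?thesis
      by (simp add: universal_AC.simps)
  next
    case False
    define u where "u = Max (\<Union>Q)"
    have "u \<in> \<Union>Q"
      unfolding u_def using fin False by (rule Max_in)
    then obtain B where B: "B \<in> Q" "u \<in> B"
      by blast
    have uniq: "C = B" if "C \<in> p" "x \<in> C" "x \<in> B" for C x
      using assms(1) that B less.prems by (meson disjoint_iff disjointD subsetD)
    have block: "insert u {v \<in> \<Union>Q - {u}. same_block p u v} = B"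
      using B less.prems uniq by (auto simp: same_block_def)
    have rest: "\<Union>Q - B = \<Union>(Q - {B})"
      using uniq less.prems by blast
    have "\<Union>(Q - {B}) \<subset> \<Union>Q"
      using rest B by blast
    hence "fst (universal_AC (same_block p) (\<Union>(Q - {B}))) = Q - {B}"
      using less fin by (simp add: psubset_card_mono subset_iff)
    moreover have "fst (universal_AC (same_block p) (\<Union>Q)) =
        insert B (fst (universal_AC (same_block p) (\<Union>Q - B)))"
      unfolding universal_AC.simps [of _ "\<Union>Q"] Let_def u_def [symmetric] block
      using False fin by (simp del: Union_iff split: prod.splits)
    ultimately show ?thesis
      using rest B by auto
  qed
qed

lemma universal_AC_correct:
  assumes "finite S" "partition_on S p"
  shows "fst (universal_AC (same_block p) S) = p"
  using universal_AC_subpartition [of p p] assms by (auto simp: partition_on_def)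

(* P(z,q) as a formal power series in z.  The parameter q ranges over an arbitrary field of
   characteristic 0; the formal version is the case where q is the indeterminate of the
   field of rational functions (rat poly fract) or of formal Laurent series (rat fls). *)
definition query_gf :: "'a::field_char_0 \<Rightarrow> 'a fps" where
  "query_gf q = Abs_fps (\<lambda>n. \<Sum>p | partition_on {1..n} p. q ^ queries p / fact n)"

definition q_pochhammer :: "'a::comm_ring_1 \<Rightarrow> 'a \<Rightarrow> nat \<Rightarrow> 'a" where
  "q_pochhammer a q k = (\<Prod>j<k. 1 - a * q ^ j)"

(* The first argument is a power series to be substituted for z; it must have constant
   coefficient 0, otherwise fps_compose is not a genuine substitution. *)
definition Poch :: "'a::field_char_0 fps \<Rightarrow> 'a \<Rightarrow> 'a \<Rightarrow> 'a fps" where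
  "Poch z a q = fps_compose (Abs_fps (\<lambda>k. q_pochhammer a q k / fact k)) z"

end

theory Submission
  imports Defs
begin

text \<open>
  Splitting off the block of the largest item \<open>u\<close> of an \<open>(n+1)\<close>-set costs \<open>n\<close> queries and leaves an
  arbitrary subset of the other items to be partitioned, so the totals \<open>W\<^sub>n = \<Sum>p. q ^ queries p\<close>
  satisfy \<open>W\<^sub>n\<^sub>+\<^sub>1 = q\<^sup>n (\<Sum>k. (n choose k) W\<^sub>k)\<close>, that is \<open>P' (z) = P (q z) e\<^sup>q\<^sup>z\<close>.  Put
  \<open>c = q / (1 - q)\<close> and let \<open>F\<close> be the Pochhammer factor.  The step of the \<open>q\<close>-factorial
  gives \<open>F' (z) = F (q z) - c F (z)\<close>, and as \<open>c q + q = c\<close>, the product \<open>F (z) e\<^sup>c\<^sup>z\<close> solves the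
  same equation.
\<close>

text \<open>The oracle is consulted only on items of \<open>S\<close>. Once a block has been removed
  from the items, the oracle of a partition can thus be exchanged for that of the partition without
  this block.\<close>

lemma universal_AC_cong:
  assumes "\<And>x y. x \<in> S \<Longrightarrow> y \<in> S \<Longrightarrow> orc x y = orc' x y"
  shows "universal_AC orc S = universal_AC orc' S"
  using assms
proof (induction orc S rule: universal_AC.induct)
  case (1 orc S)
  show ?case
  proof (cases "S = {} \<or> infinite S")
    case True
    thus ?thesis
      by (subst (1 2) universal_AC.simps) simp
  next
    case False
    define u where "u = Max S"
    define block where "block = insert u {v \<in> S - {u}. orc u v}"
    have "u \<in> S"
      using False by (simp add: u_def)
    hence block': "insert u {v \<in> S - {u}. orc' u v} = block"
      using 1(2) by (auto simp: block_def)
    have IH: "universal_AC orc (S - block) = universal_AC orc' (S - block)"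
      using False 1(2) by (intro 1(1)[OF False u_def refl block_def]) auto
    show ?thesis
      unfolding universal_AC.simps[of _ S] Let_def u_def[symmetric] block' block_def[symmetric] IH
      ..
  qed
qed

text \<open>The first round spends \<open>card S - 1\<close> queries and finds \<open>B\<close>; on
  the items \<open>S - B\<close> that remain, \<open>p\<close> and \<open>p - {B}\<close> give the
  same answers.\<close>

lemma queries_remove_Max_block:
  fixes S :: "'a::linorder set"
  assumes p: "partition_on S p" and S: "finite S" "S \<noteq> {}" and B: "B \<in> p" "Max S \<in> B"
  shows "queries p = card S - 1 + queries (p - {B})"
proof -
  define u where "u = Max S"
  have "u \<in> S"
    using S by (simp add: u_def)
  have Un: "\<Union>p = S" and disj: "disjoint p"
    using p by (auto simp: partition_on_def)
  have uniq: "C = B" if "C \<in> p" "x \<in> C" "x \<in> B" for C x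
    using disj that B by (meson disjoint_iff disjointD)
  have block: "insert u {v \<in> S - {u}. same_block p u v} = B"
    using B uniq Un by (auto simp: same_block_def u_def)
  have rest: "\<Union>(p - {B}) = S - B"
    using uniq B Un by blast
  have "universal_AC (same_block p) (S - B) = universal_AC (same_block (p - {B})) (S - B)"
    by (rule universal_AC_cong) (auto simp: same_block_def)
  hence "snd (universal_AC (same_block p) S) =
      card (S - {u}) + snd (universal_AC (same_block (p - {B})) (S - B))"
    unfolding universal_AC.simps[of _ S] Let_def u_def[symmetric] block
    using S by (simp split: prod.splits)
  thus ?thesis
    using \<open>u \<in> S\<close> S by (simp add: queries_def rest Un)
qed

lemma partition_on_insert_Diff:
  assumes "partition_on T p" "T \<subset> S"
  shows "partition_on S (insert (S - T) p)"
proof (rule partition_onI)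
  show "\<Union>(insert (S - T) p) = S"
    using assms partition_onD1[OF assms(1)] by auto
next
  show "{} \<notin> insert (S - T) p"
    using assms by (auto simp: partition_on_def)
next
  fix C D assume "C \<in> insert (S - T) p" "D \<in> insert (S - T) p" "C \<noteq> D"
  thus "disjnt C D"
    using disjointD[OF partition_onD2[OF assms(1)], of C D] partition_onD1[OF assms(1)]
    by (auto simp: disjnt_def)
qed

text \<open>The blocks avoiding \<open>u\<close> form a partition of their union \<open>T\<close>,
  and they determine the block of \<open>u\<close> as \<open>S - T\<close>. Indexing by
  \<open>T\<close> instead of by that block leaves inner sums over the partitions of
  \<open>T\<close>, as a recursion requires.\<close>

lemma sum_partition_on_split:
  fixes f :: "'a set set \<Rightarrow> 'b::comm_monoid_add"
  assumes S: "finite S" "u \<in> S"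
  shows "(\<Sum>p | partition_on S p. f p) =
    (\<Sum>T\<in>Pow (S - {u}). \<Sum>p | partition_on T p. f (insert (S - T) p))"
proof -
  define A where "A = (SIGMA T:Pow (S - {u}). {p. partition_on T p})"
  define rest where "rest = (\<lambda>p. {B \<in> p. u \<notin> B})"
  have rest_insert: "rest (insert (S - T) p) = p" if "T \<subseteq> S - {u}" "partition_on T p" for T p
    using that S partition_onD1[OF that(2)] by (auto simp: rest_def)
  have ins: "partition_on S (insert (S - T) p)" if "T \<subseteq> S - {u}" "partition_on T p" for T p
    using that S by (intro partition_on_insert_Diff) auto
  have split: "insert (S - \<Union>(rest p)) (rest p) = p \<and> (\<Union>(rest p), rest p) \<in> A"
    if p: "partition_on S p" for p
  proof -
    have Un: "\<Union>p = S" and disj: "disjoint p"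
      using p by (auto simp: partition_on_def)
    obtain B where B: "B \<in> p" "u \<in> B"
      using S Un by auto
    have uniq: "C = B" if "C \<in> p" "x \<in> C" "x \<in> B" for C x
      using disj that B by (meson disjoint_iff disjointD)
    have rest: "rest p = p - {B}"
      unfolding rest_def using B uniq by blast
    have "S - \<Union>(rest p) = B"
      unfolding rest using B uniq Un by blast
    moreover have "partition_on (\<Union>(rest p)) (rest p)"
      using p by (auto simp: rest_def partition_on_def disjoint_def)
    moreover have "\<Union>(rest p) \<subseteq> S - {u}"
      using Un by (auto simp: rest_def)
    ultimately show ?thesis
      using B rest by (auto simp: A_def)
  qed
  have "(\<Sum>p | partition_on S p. f p) = (\<Sum>(T, p)\<in>A. f (insert (S - T) p))"
  proof (rule sum.reindex_bij_witness
      [where i = "\<lambda>(T, p). insert (S - T) p" and j = "\<lambda>p. (\<Union>(rest p), rest p)"])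
    fix b assume "b \<in> A"
    thus "(\<Union>(rest (case b of (T, p) \<Rightarrow> insert (S - T) p)),
        rest (case b of (T, p) \<Rightarrow> insert (S - T) p)) = b"
      by (cases b) (auto simp: A_def rest_insert simp flip: partition_onD1 simp del: Union_iff)
  qed (use split ins in \<open>auto simp: A_def\<close>)
  also have "\<dots> = (\<Sum>T\<in>Pow (S - {u}). \<Sum>p | partition_on T p. f (insert (S - T) p))"
    unfolding A_def using S
    by (subst sum.Sigma)
      (auto intro: finitely_many_partition_on finite_subset)
  finally show ?thesis .
qed

text \<open>The first round costs the same whatever the block of \<open>Max S\<close> is, so its
  power of \<open>q\<close> factors out.\<close>

lemma sum_queries_rec:
  fixes S :: "'b::linorder set" and q :: "'a::comm_semiring_1"
  assumes S: "finite S" "S \<noteq> {}"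
  shows "(\<Sum>p | partition_on S p. q ^ queries p) =
    q ^ (card S - 1) * (\<Sum>T\<in>Pow (S - {Max S}). \<Sum>p | partition_on T p. q ^ queries p)"
proof -
  have u: "Max S \<in> S"
    using S by simp
  have "queries (insert (S - T) p) = card S - 1 + queries p"
    if T: "T \<subseteq> S - {Max S}" "partition_on T p" for T p
  proof -
    \<comment> \<open>\<open>Max S\<close> lies in \<open>S - T\<close> but in no block of
      \<open>p\<close>, so deleting \<open>S - T\<close> from the enlarged partition gives back
      \<open>p\<close>.\<close>
    have notin: "S - T \<notin> p"
      using T u partition_onD1[OF T(2)] by auto
    have "partition_on S (insert (S - T) p)"
      using T u by (intro partition_on_insert_Diff) auto
    thus ?thesis
      using queries_remove_Max_block[of S "insert (S - T) p" "S - T"] S T u notin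
      by auto
  qed
  thus ?thesis
    by (simp add: sum_partition_on_split[OF S(1) u] sum_distrib_left power_add)
qed

lemma sum_Pow_card:
  fixes g :: "nat \<Rightarrow> 'b::semiring_1"
  assumes "finite A"
  shows "(\<Sum>T\<in>Pow A. g (card T)) = (\<Sum>k\<le>card A. of_nat (card A choose k) * g k)"
proof -
  have "(\<Sum>T\<in>Pow A. g (card T)) = (\<Sum>k\<le>card A. \<Sum>T | T \<in> Pow A \<and> card T = k. g (card T))"
    using assms by (intro sum.group[symmetric]) (auto intro: card_mono)
  also have "\<dots> = (\<Sum>k\<le>card A. of_nat (card A choose k) * g k)"
    by (simp add: n_subsets[OF assms])
  finally show ?thesis .
qed

text \<open>Coefficientwise the differential equation is the recursion for the totals, and the
  constant coefficient supplies its initial value. The set \<open>S\<close> is arbitrary because the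
  subsets in the recursion need not be initial segments.\<close>

lemma sum_queries_eq_fps_nth:
  fixes G :: "'a::field_char_0 fps" and S :: "'b::linorder set"
  assumes G0: "fps_nth G 0 = 1"
    and deriv: "fps_deriv G = fps_compose (G * fps_exp 1) (fps_const q * fps_X)"
    and "finite S"
  shows "(\<Sum>p | partition_on S p. q ^ queries p) = fact (card S) * fps_nth G (card S)"
  using assms(3)
proof (induction "card S" arbitrary: S rule: less_induct)
  case less
  show ?case
  proof (cases "S = {}")
    case True
    moreover have "{p. partition_on ({} :: 'b set) p} = {{}}"
      by (auto simp: partition_on_empty)
    ultimately show ?thesis
      using G0 by (simp add: queries_def universal_AC.simps[of _ "{}"])
  next
    case False
    define n where "n = card S - 1"
    have n: "card S = Suc n" "card (S - {Max S}) = n"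
      using False less.prems by (auto simp: n_def card_gt_0_iff)
    have "(\<Sum>T\<in>Pow (S - {Max S}). \<Sum>p | partition_on T p. q ^ queries p) =
        (\<Sum>T\<in>Pow (S - {Max S}). fact (card T) * fps_nth G (card T))"
    proof (intro sum.cong refl)
      fix T assume "T \<in> Pow (S - {Max S})"
      hence "T \<subset> S"
        using False less.prems Max_in[of S] by blast
      thus "(\<Sum>p | partition_on T p. q ^ queries p) = fact (card T) * fps_nth G (card T)"
        using less finite_subset by (metis psubset_card_mono psubset_imp_subset)
    qed
    also have "\<dots> = (\<Sum>k\<le>n. of_nat (n choose k) * (fact k * fps_nth G k))"
      using sum_Pow_card[of "S - {Max S}" "\<lambda>k. fact k * fps_nth G k"] less.prems n by simp
    also have "\<dots> = (\<Sum>k\<le>n. fact n * (fps_nth G k / fact (n - k)))"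
      \<comment> \<open>Here \<open>(n choose k) * fact k = fact n / fact (n - k)\<close>, and
        \<open>1 / fact (n - k)\<close> is a coefficient of the exponential series, so a Cauchy
        product appears.\<close>
      by (intro sum.cong refl) (simp add: binomial_fact)
    also have "\<dots> = fact n * fps_nth (G * fps_exp 1) n"
      by (simp add: fps_mult_nth sum_distrib_left atMost_atLeast0)
    finally have "(\<Sum>p | partition_on S p. q ^ queries p) =
        fact n * (q ^ n * fps_nth (G * fps_exp 1) n)"
      using sum_queries_rec[OF less.prems False, of q] n by simp
    \<comment> \<open>Substituting \<open>q z\<close> for \<open>z\<close> multiplies the
      coefficient of degree \<open>n\<close> by \<open>q ^ n\<close>.\<close>
    also have "q ^ n * fps_nth (G * fps_exp 1) n = of_nat (Suc n) * fps_nth G (Suc n)"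
      using arg_cong[OF deriv, of "\<lambda>f. fps_nth f n"] by (simp add: fps_compose_linear)
    finally show ?thesis
      by (simp add: n algebra_simps)
  qed
qed

theorem theorem9:
  fixes q :: "'a::field_char_0"
  assumes "q \<noteq> 0" and "q \<noteq> 1"
  shows "query_gf q =
           Poch (fps_const (- (q / (1 - q))) * fps_X) ((1 - q) / q) q * fps_exp (q / (1 - q))"
proof -
  define c where "c = q / (1 - q)"
  define a where "a = (1 - q) / q"
  define F where "F = Poch (fps_const (- c) * fps_X) a q"
  define G where "G = F * fps_exp c"
  \<comment> \<open>The hypotheses on \<open>q\<close> enter here. The first identity normalises the
    term \<open>F (q z)\<close> in the equation for \<open>F\<close>, the second matches the
    exponentials.\<close>
  have ca: "c * a = 1" and cq: "c * q + q = c"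
    using assms by (auto simp: c_def a_def field_simps)
  have F_nth: "fps_nth F k = (- c) ^ k * (q_pochhammer a q k / fact k)" for k
    unfolding F_def Poch_def fps_compose_linear by simp
  have F': "fps_deriv F = fps_compose F (fps_const q * fps_X) - fps_const c * F"
  proof (rule fps_ext)
    fix k
    have "fps_nth (fps_deriv F) k = (- c) ^ Suc k * (q_pochhammer a q (Suc k) / fact k)"
      unfolding fps_deriv_nth F_nth by (simp add: field_simps del: of_nat_Suc)
    \<comment> \<open>The new factors \<open>- c\<close> and \<open>1 - a * q ^ k\<close> multiply
      to \<open>(c * a) * q ^ k - c\<close>.\<close>
    also have "\<dots> = (c * a) * q ^ k * fps_nth F k - c * fps_nth F k"
      by (simp add: F_nth q_pochhammer_def algebra_simps diff_divide_distrib)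
    finally show "fps_nth (fps_deriv F) k =
        fps_nth (fps_compose F (fps_const q * fps_X) - fps_const c * F) k"
      by (simp add: ca fps_compose_linear)
  qed
  have "fps_deriv G = fps_compose F (fps_const q * fps_X) * fps_exp c"
    by (simp add: G_def F' algebra_simps)
  \<comment> \<open>Since \<open>(c + 1) * q = c\<close>, the factor \<open>fps_exp c\<close> is
    itself a series in \<open>q z\<close>, which makes the whole right-hand side one
    substitution.\<close>
  also have "fps_exp c = fps_compose (fps_exp c * fps_exp 1) (fps_const q * fps_X)"
    using cq by (simp only: fps_exp_add_mult[symmetric] fps_exp_compose_linear)
      (simp add: algebra_simps)
  finally have G': "fps_deriv G = fps_compose (G * fps_exp 1) (fps_const q * fps_X)"
    by (simp add: G_def fps_compose_mult_distrib mult.assoc)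
  have G0: "fps_nth G 0 = 1"
    by (simp add: G_def F_nth q_pochhammer_def)
  have "query_gf q = G"
    using sum_queries_eq_fps_nth[OF G0 G', of "{1..n}" for n :: nat]
    by (intro fps_ext) (simp add: query_gf_def sum_divide_distrib[symmetric])
  thus ?thesis
    by (simp only: G_def F_def c_def a_def)
qed

end
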